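(* Let market data and the set UMFS be as defined in the context. For each MIC bid $c\in C$ let $F_c$ (fixed cost) and $V_c$ (variable cost) be given real numbers, and set $\overline{M_c}:=F_c$. Then for every point $(x,y,u,n,\pi,v,s,d^a,d^r,du^a,du^r)$ of UMFS and every $c\in C$, the minimum income condition $$(u_c=1)\ \Longrightarrow\ \sum_{h\in H_c}(-P_{hc}x_{hc})\,\pi_{l(hc),t(hc)}\ \ge\ F_c+\sum_{h\in H_c}(-P_{hc}x_{hc})V_c$$ holds if and only if the linear inequality $$s_c-\sum_{h\in H_c}(P_{hc}\lambda^{hc})x_{hc}\ \ge\ F_c+\sum_{h\in H_c}(-P_{hc}x_{hc})V_c-\overline{M_c}(1-u_c)$$ holds.
   Context: **Data.** All index sets are finite. $I$ is the set of hourly bids $i$, $J$ the set of block bids $j$, $C$ the set of MIC bids $c$; each $c\in C$ has a set $H_c$ of hourly suborders, a suborder $h\in H_c$ being denoted $hc$. Locations are indexed by $l$, time slots by $t$. Each hourly bid $i$ (resp. suborder $hc$) has a location $l(i)$ (resp. $l(hc)$) and a time slot $t(i)$ (resp. $t(hc)$); each block bid $j$ has a location $l(j)$. $I_{lt}$ (resp. $HC_{lt}$) is the set of hourly bids (resp. of suborders of all MIC bids) with location $l$ and time slot $t$; $J_l$ is the set of block bids at location $l$. Real parameters: powers $P_i$, $P_{hc}$, $P^t_j$ (negative for sell, positive for buy), limit prices $\lambda^i,\lambda^{hc},\lambda^j$, network parameters $a_{m,k}$, $e^k_{l,t}$, $w_m$ ($m\in N$, $k\in K$). Write $P_j\lambda^j:=\sum_t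 P^t_j\lambda^j$. **Price bound and big-M constants.** $\bar\pi>0$ is a fixed real number such that all limit prices $\lambda^i,\lambda^{hc},\lambda^j$ lie in $[-\bar\pi,\bar\pi]$. $M_j$ ($j\in J$) and $M_c$ ($c\in C$) are fixed constants with $M_j\ge 2\bar\pi\sum_t|P^t_j|$ and $M_c\ge 2\bar\pi\sum_{h\in H_c}|P_{hc}|$. **Variables.** $x=((x_i)_{i\in I},(x_{hc})_{h\in H_c,c\in C})$, $y=(y_j)_{j\in J}$, $u=(u_c)_{c\in C}$, $n=(n_k)_{k\in K}$, $\pi=(\pi_{l,t})$, $v=(v_m)_{m\in N}$, $s=((s_i),(s_j),(s_{hc}),(s_c))$, $d^a,d^r$ (indexed by $J$), $du^a,du^r$ (indexed by $C$). All are real; $n$ and $\pi$ are free in sign. **UMFS** (Uniform Market Clearing Feasible Set) is the set of all points $(x,y,u,n,\pi,v,s,d^a,d^r,du^a,du^r)$ satisfying: - $\sum_i\lambda^iP_ix_i+\sum_{c\in C,h\in H_c}\lambda^{hc}P_{hc}x_{hc}+\sum_{j,t}\lambda^jP^t_jy_j\ \ge\ \sum_is_i+\sum_js_j+\sum_cs_c-\sum_{j\in J}d^a_j+\sum_mw_mv_m$; - $x_i\le1$ ($i\in I$); $y_j\le1$ ($j\in J$); $x_{hc}\le u_c$ ($h\in H_c,c\in C$); $u_c\le1$ ($c\in C$); - $\sum_{i\in I_{lt}}P_ix_i+\sum_{j\in J_l}P^t_jy_j+\sum_{hc\in HC_{lt}}P_{hc}x_{hc}=\sum_ke^k_{l,t}n_k$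 for all $(l,t)$; $\sum_ka_{m,k}n_k\le w_m$ ($m\in N$); - $x,y,u\ge0$; $y,u$ integer; - $s_i+P_i\pi_{l(i),t(i)}\ge P_i\lambda^i$ ($i\in I$); $s_{hc}+P_{hc}\pi_{l(hc),t(hc)}\ge P_{hc}\lambda^{hc}$ ($h\in H_c,c\in C$); - $s_j+d^r_j-d^a_j+\sum_tP^t_j\pi_{l(j),t}\ge P_j\lambda^j$ ($j\in J$); $s_c+du^r_c\ge\sum_{h\in H_c}s_{hc}$ ($c\in C$); - $d^r_j\le M_j(1-y_j)$ and $d^a_j\le M_jy_j$ ($j\in J$); $du^r_c\le M_c(1-u_c)$ and $du^a_c=0$ ($c\in C$); - $\sum_ma_{m,k}v_m-\sum_{l,t}e^k_{l,t}\pi_{l,t}=0$ ($k\in K$); - all components of $s,d^a,d^r,du^a,du^r,v$ are $\ge0$. *)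

theory Defs
  imports Complex_Main
begin

(* A suborder hc is represented by the two arguments c and h, with h in suborders D c, so the
   same h may occur in several MIC bids. Parameters and variables are total functions of which
   only the values on the index sets matter. *)
record ('i, 'j, 'c, 'h, 'l, 't, 'm, 'k) market =
  hourly_bids :: "'i set"                      (* I *)
  block_bids :: "'j set"                       (* J *)
  mic_bids :: "'c set"                         (* C *)
  suborders :: "'c \<Rightarrow> 'h set"                 (* H_c *)
  locations :: "'l set"
  time_slots :: "'t set"
  net_constraints :: "'m set"                  (* N *)
  net_elements :: "'k set"                     (* K *)
  loc_i :: "'i \<Rightarrow> 'l"
  time_i :: "'i \<Rightarrow> 't"
  loc_hc :: "'c \<Rightarrow> 'h \<Rightarrow> 'l"
  time_hc :: "'c \<Rightarrow> 'h \<Rightarrow> 't"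
  loc_j :: "'j \<Rightarrow> 'l"
  P_i :: "'i \<Rightarrow> real"
  P_hc :: "'c \<Rightarrow> 'h \<Rightarrow> real"
  P_j :: "'j \<Rightarrow> 't \<Rightarrow> real"                   (* P^t_j *)
  lam_i :: "'i \<Rightarrow> real"
  lam_hc :: "'c \<Rightarrow> 'h \<Rightarrow> real"
  lam_j :: "'j \<Rightarrow> real"
  net_a :: "'m \<Rightarrow> 'k \<Rightarrow> real"                 (* a_{m,k} *)
  net_e :: "'k \<Rightarrow> 'l \<Rightarrow> 't \<Rightarrow> real"           (* e^k_{l,t} *)
  net_w :: "'m \<Rightarrow> real"                       (* w_m *)
  price_bound :: real                          (* bar pi *)
  M_j :: "'j \<Rightarrow> real"
  M_c :: "'c \<Rightarrow> real"

definition market_data :: "('i, 'j, 'c, 'h, 'l, 't, 'm, 'k) market \<Rightarrow> bool" where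
  "market_data D \<longleftrightarrow>
     finite (hourly_bids D) \<and> finite (block_bids D) \<and> finite (mic_bids D) \<and>
     (\<forall>c\<in>mic_bids D. finite (suborders D c)) \<and>
     finite (locations D) \<and> finite (time_slots D) \<and>
     finite (net_constraints D) \<and> finite (net_elements D) \<and>
     (\<forall>i\<in>hourly_bids D. loc_i D i \<in> locations D \<and> time_i D i \<in> time_slots D) \<and>
     (\<forall>c\<in>mic_bids D. \<forall>h\<in>suborders D c.
        loc_hc D c h \<in> locations D \<and> time_hc D c h \<in> time_slots D) \<and>
     (\<forall>j\<in>block_bids D. loc_j D j \<in> locations D) \<and>
     price_bound D > 0 \<and>
     (\<forall>i\<in>hourly_bids D. lam_i D i \<in> {- price_bound D..price_bound D}) \<and>
     (\<forall>c\<in>mic_bids D. \<forall>h\<in>suborders D c. lam_hc D c h \<in> {- price_bound D..price_bound D}) \<and>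
     (\<forall>j\<in>block_bids D. lam_j D j \<in> {- price_bound D..price_bound D}) \<and>
     (\<forall>j\<in>block_bids D. M_j D j \<ge> 2 * price_bound D * (\<Sum>t\<in>time_slots D. \<bar>P_j D j t\<bar>)) \<and>
     (\<forall>c\<in>mic_bids D. M_c D c \<ge> 2 * price_bound D * (\<Sum>h\<in>suborders D c. \<bar>P_hc D c h\<bar>))"

definition hourly_bids_at ::
  "('i, 'j, 'c, 'h, 'l, 't, 'm, 'k) market \<Rightarrow> 'l \<Rightarrow> 't \<Rightarrow> 'i set" where
  "hourly_bids_at D l t = {i \<in> hourly_bids D. loc_i D i = l \<and> time_i D i = t}"

definition block_bids_at ::
  "('i, 'j, 'c, 'h, 'l, 't, 'm, 'k) market \<Rightarrow> 'l \<Rightarrow> 'j set" where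
  "block_bids_at D l = {j \<in> block_bids D. loc_j D j = l}"

definition suborders_at ::
  "('i, 'j, 'c, 'h, 'l, 't, 'm, 'k) market \<Rightarrow> 'l \<Rightarrow> 't \<Rightarrow> ('c \<times> 'h) set" where
  "suborders_at D l t =
     {(c, h). c \<in> mic_bids D \<and> h \<in> suborders D c \<and> loc_hc D c h = l \<and> time_hc D c h = t}"

record ('i, 'j, 'c, 'h, 'l, 't, 'm, 'k) market_point =
  x_i :: "'i \<Rightarrow> real"
  x_hc :: "'c \<Rightarrow> 'h \<Rightarrow> real"
  y_j :: "'j \<Rightarrow> real"
  u_c :: "'c \<Rightarrow> real"
  n_k :: "'k \<Rightarrow> real"
  price :: "'l \<Rightarrow> 't \<Rightarrow> real"                 (* pi_{l,t} *)
  v_m :: "'m \<Rightarrow> real"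
  s_i :: "'i \<Rightarrow> real"
  s_j :: "'j \<Rightarrow> real"
  s_hc :: "'c \<Rightarrow> 'h \<Rightarrow> real"
  s_c :: "'c \<Rightarrow> real"
  da_j :: "'j \<Rightarrow> real"
  dr_j :: "'j \<Rightarrow> real"
  dua_c :: "'c \<Rightarrow> real"
  dur_c :: "'c \<Rightarrow> real"

definition UMFS :: "('i, 'j, 'c, 'h, 'l, 't, 'm, 'k) market \<Rightarrow>
    ('i, 'j, 'c, 'h, 'l, 't, 'm, 'k) market_point set" where
  "UMFS D = {p.
     (\<Sum>i\<in>hourly_bids D. lam_i D i * P_i D i * x_i p i)
       + (\<Sum>c\<in>mic_bids D. \<Sum>h\<in>suborders D c. lam_hc D c h * P_hc D c h * x_hc p c h)
       + (\<Sum>j\<in>block_bids D. \<Sum>t\<in>time_slots D. lam_j D j * P_j D j t * y_j p j)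
     \<ge> (\<Sum>i\<in>hourly_bids D. s_i p i) + (\<Sum>j\<in>block_bids D. s_j p j) + (\<Sum>c\<in>mic_bids D. s_c p c)
       - (\<Sum>j\<in>block_bids D. da_j p j) + (\<Sum>m\<in>net_constraints D. net_w D m * v_m p m) \<and>

     (\<forall>i\<in>hourly_bids D. x_i p i \<le> 1) \<and>
     (\<forall>j\<in>block_bids D. y_j p j \<le> 1) \<and>
     (\<forall>c\<in>mic_bids D. \<forall>h\<in>suborders D c. x_hc p c h \<le> u_c p c) \<and>
     (\<forall>c\<in>mic_bids D. u_c p c \<le> 1) \<and>

     (\<forall>l\<in>locations D. \<forall>t\<in>time_slots D.
        (\<Sum>i\<in>hourly_bids_at D l t. P_i D i * x_i p i)
          + (\<Sum>j\<in>block_bids_at D l. P_j D j t * y_j p j)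
          + (\<Sum>(c, h)\<in>suborders_at D l t. P_hc D c h * x_hc p c h)
        = (\<Sum>k\<in>net_elements D. net_e D k l t * n_k p k)) \<and>
     (\<forall>m\<in>net_constraints D. (\<Sum>k\<in>net_elements D. net_a D m k * n_k p k) \<le> net_w D m) \<and>

     (\<forall>i\<in>hourly_bids D. x_i p i \<ge> 0) \<and>
     (\<forall>c\<in>mic_bids D. \<forall>h\<in>suborders D c. x_hc p c h \<ge> 0) \<and>
     (\<forall>j\<in>block_bids D. y_j p j \<ge> 0 \<and> y_j p j \<in> \<int>) \<and>
     (\<forall>c\<in>mic_bids D. u_c p c \<ge> 0 \<and> u_c p c \<in> \<int>) \<and>

     (\<forall>i\<in>hourly_bids D.
        s_i p i + P_i D i * price p (loc_i D i) (time_i D i) \<ge> P_i D i * lam_i D i) \<and>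
     (\<forall>c\<in>mic_bids D. \<forall>h\<in>suborders D c.
        s_hc p c h + P_hc D c h * price p (loc_hc D c h) (time_hc D c h)
          \<ge> P_hc D c h * lam_hc D c h) \<and>
     (\<forall>j\<in>block_bids D.
        s_j p j + dr_j p j - da_j p j + (\<Sum>t\<in>time_slots D. P_j D j t * price p (loc_j D j) t)
          \<ge> (\<Sum>t\<in>time_slots D. P_j D j t * lam_j D j)) \<and>
     (\<forall>c\<in>mic_bids D. s_c p c + dur_c p c \<ge> (\<Sum>h\<in>suborders D c. s_hc p c h)) \<and>

     (\<forall>j\<in>block_bids D. dr_j p j \<le> M_j D j * (1 - y_j p j) \<and> da_j p j \<le> M_j D j * y_j p j) \<and>
     (\<forall>c\<in>mic_bids D. dur_c p c \<le> M_c D c * (1 - u_c p c) \<and> dua_c p c = 0) \<and>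

     (\<forall>k\<in>net_elements D.
        (\<Sum>m\<in>net_constraints D. net_a D m k * v_m p m)
          - (\<Sum>l\<in>locations D. \<Sum>t\<in>time_slots D. net_e D k l t * price p l t) = 0) \<and>

     (\<forall>i\<in>hourly_bids D. s_i p i \<ge> 0) \<and>
     (\<forall>j\<in>block_bids D. s_j p j \<ge> 0 \<and> da_j p j \<ge> 0 \<and> dr_j p j \<ge> 0) \<and>
     (\<forall>c\<in>mic_bids D. \<forall>h\<in>suborders D c. s_hc p c h \<ge> 0) \<and>
     (\<forall>c\<in>mic_bids D. s_c p c \<ge> 0 \<and> dua_c p c \<ge> 0 \<and> dur_c p c \<ge> 0) \<and>
     (\<forall>m\<in>net_constraints D. v_m p m \<ge> 0)}"

end

theory Submission
  imports Defs
begin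

text \<open>
  A point of UMFS satisfies weak duality bid by bid: the surplus variable of every bid is at
  least the surplus of its cleared quantity at the prices \<open>\<pi>\<close>, where integrality of \<open>y\<close> and \<open>u\<close> and
  the big-M constraints reduce the block and MIC conditions to the cases 0 and 1. Summed over all
  bids, and combined with the balance, network and dual network constraints, these inequalities
  give the converse of the first (strong duality) constraint, so each of them is tight. Hence
  \<open>s\<^sub>c = \<Sum>\<^sub>h P\<^sub>h\<^sub>c x\<^sub>h\<^sub>c (\<lambda>\<^sup>h\<^sup>c - \<pi>)\<close>, and both sides of the claimed equivalence are the same
  inequality if \<open>u\<^sub>c = 1\<close>, while both are trivially true if \<open>u\<^sub>c = 0\<close>.
\<close>

text \<open>Every \<open>a\<close> lies in exactly one fibre of \<open>f\<close>. This turns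
  price-weighted balances at the locations into sums over bids.\<close>

lemma sum_group_weighted:
  fixes q g :: "_ \<Rightarrow> real"
  assumes "finite A" "finite L" "\<And>a. a \<in> A \<Longrightarrow> f a \<in> L"
  shows "(\<Sum>l\<in>L. q l * (\<Sum>a\<in>{a \<in> A. f a = l}. g a)) = (\<Sum>a\<in>A. g a * q (f a))"
proof -
  have "(\<Sum>a\<in>A. g a * q (f a)) = (\<Sum>l\<in>L. \<Sum>a\<in>{a \<in> A. f a = l}. g a * q (f a))"
    using assms by (intro sum.group [symmetric]) auto
  then show ?thesis
    by (simp add: sum_distrib_left mult.commute)
qed

text \<open>The one-key version applied to the pair key (location, time slot).\<close>

lemma sum_group_weighted2:
  fixes q :: "_ \<Rightarrow> _ \<Rightarrow> real" and g :: "_ \<Rightarrow> real"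
  assumes "finite A" "finite L" "finite T" "\<And>a. a \<in> A \<Longrightarrow> f a \<in> L \<and> k a \<in> T"
  shows "(\<Sum>l\<in>L. \<Sum>t\<in>T. q l t * (\<Sum>a\<in>{a \<in> A. f a = l \<and> k a = t}. g a))
       = (\<Sum>a\<in>A. g a * q (f a) (k a))"
proof -
  have "(\<Sum>z\<in>L \<times> T. case_prod q z * (\<Sum>a\<in>{a \<in> A. (f a, k a) = z}. g a))
      = (\<Sum>a\<in>A. g a * case_prod q (f a, k a))"
    using assms by (intro sum_group_weighted) auto
  then show ?thesis
    by (simp add: sum.cartesian_product split_def prod_eq_iff)
qed

text \<open>One strict term would make the sums strictly ordered. This passes from tightness of the
  total to tightness for each bid.\<close>

lemma sum_eq_imp_eq_of_le:
  fixes f g :: "_ \<Rightarrow> real"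
  assumes "finite A" "\<And>a. a \<in> A \<Longrightarrow> f a \<le> g a" "sum g A \<le> sum f A" "a \<in> A"
  shows "f a = g a"
proof (rule ccontr)
  assume "f a \<noteq> g a"
  then have "sum f A < sum g A"
    using assms by (intro sum_strict_mono_ex1) (auto intro!: bexI [of _ a] simp: less_le)
  then show False
    using assms by simp
qed

lemma real_Int_0_1:
  fixes z :: real
  assumes "z \<in> \<int>" "0 \<le> z" "z \<le> 1"
  shows "z = 0 \<or> z = 1"
proof -
  obtain k :: int where "z = of_int k"
    using assms Ints_cases by blast
  with assms have "k = 0 \<or> k = 1" by auto
  with \<open>z = of_int k\<close> show ?thesis by auto
qed

text \<open>The value at the prices \<open>\<pi>\<close> of the total cleared quantity is the congestion revenue, which
  the dual network constraint bounds by \<open>\<Sum>\<^sub>m w\<^sub>m v\<^sub>m\<close>.\<close>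

lemma UMFS_cleared_value_le:
  assumes D: "market_data D" and p: "p \<in> UMFS D"
  shows "(\<Sum>i\<in>hourly_bids D. P_i D i * x_i p i * price p (loc_i D i) (time_i D i))
       + (\<Sum>j\<in>block_bids D. \<Sum>t\<in>time_slots D. P_j D j t * y_j p j * price p (loc_j D j) t)
       + (\<Sum>c\<in>mic_bids D. \<Sum>h\<in>suborders D c.
            P_hc D c h * x_hc p c h * price p (loc_hc D c h) (time_hc D c h))
     \<le> (\<Sum>m\<in>net_constraints D. net_w D m * v_m p m)" (is "?I + ?J + ?C \<le> _")
proof -
  let ?L = "locations D" and ?T = "time_slots D"
  let ?N = "net_constraints D" and ?K = "net_elements D"
  have fin: "finite (hourly_bids D)" "finite (block_bids D)" "finite (mic_bids D)"
      "\<And>c. c \<in> mic_bids D \<Longrightarrow> finite (suborders D c)" "finite ?L" "finite ?T"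
    using D by (auto simp: market_data_def)
  have I: "(\<Sum>l\<in>?L. \<Sum>t\<in>?T. price p l t * (\<Sum>i\<in>hourly_bids_at D l t. P_i D i * x_i p i)) = ?I"
    unfolding hourly_bids_at_def using D
    by (intro sum_group_weighted2) (auto simp: market_data_def)
  \<comment> \<open>A block bid has a location but spans all time slots, so the grouping is by
    location alone, with \<open>t\<close> fixed.\<close>
  have "(\<Sum>l\<in>?L. \<Sum>t\<in>?T. price p l t * (\<Sum>j\<in>block_bids_at D l. P_j D j t * y_j p j))
      = (\<Sum>t\<in>?T. \<Sum>l\<in>?L. price p l t * (\<Sum>j\<in>block_bids_at D l. P_j D j t * y_j p j))"
    by (rule sum.swap)
  also have "\<dots> = (\<Sum>t\<in>?T. \<Sum>j\<in>block_bids D. P_j D j t * y_j p j * price p (loc_j D j) t)"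
    unfolding block_bids_at_def using D
    by (intro sum.cong refl sum_group_weighted) (auto simp: market_data_def)
  also have "\<dots> = ?J"
    by (rule sum.swap)
  finally have J:
    "(\<Sum>l\<in>?L. \<Sum>t\<in>?T. price p l t * (\<Sum>j\<in>block_bids_at D l. P_j D j t * y_j p j)) = ?J" .
  \<comment> \<open>Suborders as pairs, with the set written as a fibre to match the grouping
    lemma.\<close>
  have at: "suborders_at D l t = {z \<in> Sigma (mic_bids D) (suborders D).
      case_prod (loc_hc D) z = l \<and> case_prod (time_hc D) z = t}" for l t
    by (auto simp: suborders_at_def)
  have "(\<Sum>l\<in>?L. \<Sum>t\<in>?T. price p l t * (\<Sum>z\<in>suborders_at D l t. case z of (c, h) \<Rightarrow> P_hc D c h * x_hc p c h))
      = (\<Sum>z\<in>Sigma (mic_bids D) (suborders D). (case z of (c, h) \<Rightarrow> P_hc D c h * x_hc p c h)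
           * price p (case_prod (loc_hc D) z) (case_prod (time_hc D) z))"
    unfolding at using D
    by (intro sum_group_weighted2) (auto simp: market_data_def)
  also have "\<dots> = ?C"
    using fin by (simp add: sum.Sigma split_def)
  finally have C: "(\<Sum>l\<in>?L. \<Sum>t\<in>?T. price p l t
      * (\<Sum>z\<in>suborders_at D l t. case z of (c, h) \<Rightarrow> P_hc D c h * x_hc p c h)) = ?C" .
  have balance: "(\<Sum>i\<in>hourly_bids_at D l t. P_i D i * x_i p i)
          + (\<Sum>j\<in>block_bids_at D l. P_j D j t * y_j p j)
          + (\<Sum>(c, h)\<in>suborders_at D l t. P_hc D c h * x_hc p c h)
        = (\<Sum>k\<in>?K. net_e D k l t * n_k p k)" if "l \<in> ?L" "t \<in> ?T" for l t
    using p that unfolding UMFS_def by simp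
  have dual: "(\<Sum>l\<in>?L. \<Sum>t\<in>?T. net_e D k l t * price p l t)
      = (\<Sum>m\<in>?N. net_a D m k * v_m p m)" if "k \<in> ?K" for k
    using p that unfolding UMFS_def by simp
  have net: "(\<Sum>k\<in>?K. net_a D m k * n_k p k) \<le> net_w D m" "v_m p m \<ge> 0" if "m \<in> ?N" for m
    using p that unfolding UMFS_def by simp_all
  \<comment> \<open>The balance at (l,t), multiplied by its price and summed over all (l,t).\<close>
  have "?I + ?J + ?C = (\<Sum>l\<in>?L. \<Sum>t\<in>?T. price p l t * (\<Sum>k\<in>?K. net_e D k l t * n_k p k))"
    unfolding I [symmetric] J [symmetric] C [symmetric]
    by (simp add: sum.distrib [symmetric] distrib_left [symmetric] balance)
  also have "\<dots> = (\<Sum>k\<in>?K. n_k p k * (\<Sum>l\<in>?L. \<Sum>t\<in>?T. net_e D k l t * price p l t))"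
    \<comment> \<open>Fixing \<open>B\<close> moves only the sum over \<open>?K\<close> outward and
      keeps the rewriting from looping.\<close>
    unfolding sum_distrib_left sum.swap [where B = ?K]
    by (simp add: mult_ac)
  also have "\<dots> = (\<Sum>k\<in>?K. n_k p k * (\<Sum>m\<in>?N. net_a D m k * v_m p m))"
    by (simp add: dual)
  also have "\<dots> = (\<Sum>m\<in>?N. (\<Sum>k\<in>?K. net_a D m k * n_k p k) * v_m p m)"
    unfolding sum_distrib_left sum_distrib_right sum.swap [where A = ?K]
    by (simp add: mult_ac)
  also have "\<dots> \<le> (\<Sum>m\<in>?N. net_w D m * v_m p m)"
    by (intro sum_mono mult_right_mono net)
  finally show ?thesis .
qed

text \<open>With surplus r \<le> s at full acceptance, 0 \<le> x \<le> 1 and s \<ge> 0 give x r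
  \<le> x s \<le> s.\<close>

lemma UMFS_hourly_surplus_le:
  assumes p: "p \<in> UMFS D" and i: "i \<in> hourly_bids D"
  shows "P_i D i * x_i p i * (lam_i D i - price p (loc_i D i) (time_i D i)) \<le> s_i p i"
proof -
  have x: "0 \<le> x_i p i" "x_i p i \<le> 1" and s: "0 \<le> s_i p i"
    and dual: "P_i D i * (lam_i D i - price p (loc_i D i) (time_i D i)) \<le> s_i p i"
    using p i unfolding UMFS_def by (simp_all add: algebra_simps)
  show ?thesis
    using mult_left_mono [OF dual x(1)] mult_right_mono [OF x(2) s] by (simp add: mult_ac)
qed

text \<open>If y = 0, the left side vanishes and big-M gives \<open>da_j\<close> \<le> 0. If y = 1,
  it gives \<open>dr_j\<close> \<le> 0, and the dual constraint of the block is the claim.\<close>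

lemma UMFS_block_surplus_le:
  assumes p: "p \<in> UMFS D" and j: "j \<in> block_bids D"
  shows "(\<Sum>t\<in>time_slots D. P_j D j t * y_j p j * (lam_j D j - price p (loc_j D j) t))
       \<le> s_j p j - da_j p j"
proof -
  have "y_j p j \<in> \<int>" "0 \<le> y_j p j" "y_j p j \<le> 1"
    using p j unfolding UMFS_def by simp_all
  then consider "y_j p j = 0" | "y_j p j = 1"
    using real_Int_0_1 by blast
  moreover have "0 \<le> s_j p j" "dr_j p j \<le> M_j D j * (1 - y_j p j)" "da_j p j \<le> M_j D j * y_j p j"
    "s_j p j + dr_j p j - da_j p j + (\<Sum>t\<in>time_slots D. P_j D j t * price p (loc_j D j) t)
      \<ge> (\<Sum>t\<in>time_slots D. P_j D j t * lam_j D j)"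
    using p j unfolding UMFS_def by simp_all
  ultimately show ?thesis
    by cases (simp_all add: right_diff_distrib sum_subtractf)
qed

lemma UMFS_u_c_cases:
  assumes "p \<in> UMFS D" "c \<in> mic_bids D"
  obtains "u_c p c = 0" "\<And>h. h \<in> suborders D c \<Longrightarrow> x_hc p c h = 0" | "u_c p c = 1"
proof -
  have u: "u_c p c \<in> \<int>" "0 \<le> u_c p c" "u_c p c \<le> 1"
    and x: "\<And>h. h \<in> suborders D c \<Longrightarrow> 0 \<le> x_hc p c h \<and> x_hc p c h \<le> u_c p c"
    using assms unfolding UMFS_def by simp_all
  show thesis
    using real_Int_0_1 [OF u] x that by force
qed

lemma UMFS_mic_surplus_le:
  assumes p: "p \<in> UMFS D" and c: "c \<in> mic_bids D"
  shows "(\<Sum>h\<in>suborders D c.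
            P_hc D c h * x_hc p c h * (lam_hc D c h - price p (loc_hc D c h) (time_hc D c h)))
       \<le> s_c p c"
  using p c
proof (cases rule: UMFS_u_c_cases)
  case 1
  have "0 \<le> s_c p c"
    using p c unfolding UMFS_def by simp
  with 1 show ?thesis by simp
next
  case 2
  have "P_hc D c h * x_hc p c h * (lam_hc D c h - price p (loc_hc D c h) (time_hc D c h))
      \<le> s_hc p c h" if h: "h \<in> suborders D c" for h
  proof -
    have x: "0 \<le> x_hc p c h" "x_hc p c h \<le> 1" and s: "0 \<le> s_hc p c h"
      and dual: "P_hc D c h * (lam_hc D c h - price p (loc_hc D c h) (time_hc D c h)) \<le> s_hc p c h"
      using p c h 2 unfolding UMFS_def by (auto simp: algebra_simps)
    show ?thesis
      using mult_left_mono [OF dual x(1)] mult_right_mono [OF x(2) s] by (simp add: mult_ac)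
  qed
  then have "(\<Sum>h\<in>suborders D c.
        P_hc D c h * x_hc p c h * (lam_hc D c h - price p (loc_hc D c h) (time_hc D c h)))
      \<le> (\<Sum>h\<in>suborders D c. s_hc p c h)"
    by (rule sum_mono)
  \<comment> \<open>Since u = 1, the big-M bound leaves \<open>dur_c\<close> \<le> 0, so
    \<open>s_c\<close> alone covers the suborder surpluses.\<close>
  moreover have "(\<Sum>h\<in>suborders D c. s_hc p c h) \<le> s_c p c + dur_c p c"
      "dur_c p c \<le> M_c D c * (1 - u_c p c)"
    using p c unfolding UMFS_def by simp_all
  ultimately show ?thesis
    using 2 by simp
qed

lemma UMFS_mic_surplus_eq:
  assumes D: "market_data D" and p: "p \<in> UMFS D" and c: "c \<in> mic_bids D"
  shows "(\<Sum>h\<in>suborders D c.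
            P_hc D c h * x_hc p c h * (lam_hc D c h - price p (loc_hc D c h) (time_hc D c h)))
       = s_c p c"
proof -
  let ?C = "\<lambda>c. \<Sum>h\<in>suborders D c.
      P_hc D c h * x_hc p c h * (lam_hc D c h - price p (loc_hc D c h) (time_hc D c h))"
  have "(\<Sum>i\<in>hourly_bids D. P_i D i * x_i p i * (lam_i D i - price p (loc_i D i) (time_i D i)))
      \<le> (\<Sum>i\<in>hourly_bids D. s_i p i)"
    by (intro sum_mono UMFS_hourly_surplus_le p)
  moreover have "(\<Sum>j\<in>block_bids D. \<Sum>t\<in>time_slots D.
        P_j D j t * y_j p j * (lam_j D j - price p (loc_j D j) t))
      \<le> (\<Sum>j\<in>block_bids D. s_j p j) - (\<Sum>j\<in>block_bids D. da_j p j)"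
    unfolding sum_subtractf [symmetric] by (intro sum_mono UMFS_block_surplus_le p)
  moreover have "(\<Sum>i\<in>hourly_bids D. lam_i D i * P_i D i * x_i p i)
       + (\<Sum>c\<in>mic_bids D. \<Sum>h\<in>suborders D c. lam_hc D c h * P_hc D c h * x_hc p c h)
       + (\<Sum>j\<in>block_bids D. \<Sum>t\<in>time_slots D. lam_j D j * P_j D j t * y_j p j)
     \<ge> (\<Sum>i\<in>hourly_bids D. s_i p i) + (\<Sum>j\<in>block_bids D. s_j p j) + (\<Sum>c\<in>mic_bids D. s_c p c)
       - (\<Sum>j\<in>block_bids D. da_j p j) + (\<Sum>m\<in>net_constraints D. net_w D m * v_m p m)"
    using p unfolding UMFS_def by simp
  \<comment> \<open>Subtracting the hourly, block and congestion bounds from strong duality leaves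
    the reverse inequality for the MIC totals.\<close>
  ultimately have "sum (s_c p) (mic_bids D) \<le> sum ?C (mic_bids D)"
    using UMFS_cleared_value_le [OF D p]
    by (simp add: right_diff_distrib sum_subtractf mult_ac)
  with c show ?thesis
    using D UMFS_mic_surplus_le [OF p]
    by (intro sum_eq_imp_eq_of_le [of "mic_bids D" ?C "s_c p"]) (simp_all add: market_data_def)
qed

theorem mainTheorem3:
  fixes D :: "('i, 'j, 'c, 'h, 'l, 't, 'm, 'k) market"
    and p :: "('i, 'j, 'c, 'h, 'l, 't, 'm, 'k) market_point"
    and F V Mbar :: "'c \<Rightarrow> real"
    and c :: 'c
  assumes "market_data D"
    and "\<forall>c\<in>mic_bids D. Mbar c = F c"
    and "p \<in> UMFS D"
    and "c \<in> mic_bids D"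
  shows "(u_c p c = 1 \<longrightarrow>
            (\<Sum>h\<in>suborders D c. (- P_hc D c h * x_hc p c h) * price p (loc_hc D c h) (time_hc D c h))
              \<ge> F c + (\<Sum>h\<in>suborders D c. (- P_hc D c h * x_hc p c h) * V c))
         \<longleftrightarrow>
         s_c p c - (\<Sum>h\<in>suborders D c. (P_hc D c h * lam_hc D c h) * x_hc p c h)
           \<ge> F c + (\<Sum>h\<in>suborders D c. (- P_hc D c h * x_hc p c h) * V c)
               - Mbar c * (1 - u_c p c)"
  using assms(3,4)
proof (cases rule: UMFS_u_c_cases)
  case 1
  have "0 \<le> s_c p c"
    using assms(3,4) unfolding UMFS_def by simp
  \<comment> \<open>With u = 0 the premise of the condition is false. The linear inequality reads
    \<open>s_c\<close> \<ge> F - Mbar = 0.\<close>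
  with 1 assms show ?thesis by simp
next
  case 2
  \<comment> \<open>The limit-price terms cancel against those in the tight surplus, so exactly the
    income at market prices remains.\<close>
  have "s_c p c - (\<Sum>h\<in>suborders D c. (P_hc D c h * lam_hc D c h) * x_hc p c h)
      = (\<Sum>h\<in>suborders D c. (- P_hc D c h * x_hc p c h) * price p (loc_hc D c h) (time_hc D c h))"
    unfolding UMFS_mic_surplus_eq [OF assms(1,3,4), symmetric] sum_subtractf [symmetric]
    by (intro sum.cong) (auto simp: algebra_simps)
  with 2 show ?thesis by simp
qed

end
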